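(* Let $\emptyset\ne S\subset\{0,1\}^n$, let $f$ be a real-valued function on $\mathbb{R}^n$ with $f(x)\in\mathbb{Z}$ for every $x\in\{0,1\}^n$, let $\zeta=\min\{f(x):x\in S\}$, and let $\eta\in\mathbb{Z}$ satisfy $\zeta\le\eta$. Let $\Phi:\mathbb{R}^n\to\mathbb{S}^\ell$ be a mapping such that $\Phi(x)\in\mathbb{S}^\ell\cap\mathbb{Z}^{\ell\times\ell}$ for every $x\in\{0,1\}^n$, and let $Q\in\mathbb{S}^\ell\cap\mathbb{Z}^{\ell\times\ell}$ satisfy $\langle Q,\Phi(x)\rangle=f(x)$ for every $x\in\{0,1\}^n$. Let $g\in\mathbb{Z}^n$, $\alpha\in\mathbb{Z}$, and define $$S_{\rm a}=\{x\in S:g^Tx\le\alpha\},\qquad S_{\rm b}=\{x\in S:g^Tx\ge\alpha+1\}.$$ Let $\widehat S_{\rm a},\widehat S_{\rm b}\subseteq\mathbb{S}^\ell$ be closed convex sets with $\Phi(S_{\rm a})\subset\widehat S_{\rm a}$ and $\Phi(S_{\rm b})\subset\widehat S_{\rm b}$. Put $\zeta_{\rm b}=\min\{f(x):x\in S_{\rm b}\}$, $\hat\zeta_{\rm a}=\min\{\langle Q,X\rangle:X\in\widehat S_{\rm a}\}$ and $\hat\zeta_{\rm b}=\min\{\langle Q,X\rangle:X\in\widehat S_{\rm b}\}$. If $\eta<\hat\zeta_{\rm a}$, then $\hat\zeta_{\rm b}\le\zeta_{\rm b}=\zeta$.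
   Context: $\mathbb{S}^\ell$ is the linear space of real symmetric $\ell\times\ell$ matrices, and $\langle U,V\rangle=\sum_{i,j=1}^{\ell}U_{ij}V_{ij}$. All minima are read as infima in $[-\infty,+\infty]$, with value $+\infty$ over an empty set. *)

theory Defs
  imports "HOL-Analysis.Analysis"
begin

definition binary_points :: "(real ^ 'n) set" where
  "binary_points = {x. \<forall>i. x $ i = 0 \<or> x $ i = 1}"

definition sym_matrices :: "(real ^ 'l ^ 'l) set" where
  "sym_matrices = {X. transpose X = X}"

definition integer_matrices :: "(real ^ 'l ^ 'l) set" where
  "integer_matrices = {X. \<forall>i j. X $ i $ j \<in> \<int>}"

definition integer_vectors :: "(real ^ 'n) set" where
  "integer_vectors = {x. \<forall>i. x $ i \<in> \<int>}"

text \<open>The library inner product on matrices is the trace inner product.\<close>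

lemma matrix_inner_eq:
  fixes U V :: "real ^ 'l ^ 'l"
  shows "U \<bullet> V = (\<Sum>i\<in>UNIV. \<Sum>j\<in>UNIV. U $ i $ j * V $ i $ j)"
  by (simp add: inner_vec_def)

text \<open>The extended-real infimum; over the empty set it is \<open>\<infinity>\<close>.\<close>

definition min_value :: "('a \<Rightarrow> real) \<Rightarrow> 'a set \<Rightarrow> ereal" where
  "min_value h A = (INF x\<in>A. ereal (h x))"

end

theory Submission
  imports Defs
begin

text \<open>
  Since \<open>g \<bullet> x\<close> is an integer at every binary point \<open>x\<close>, no point of \<open>S\<close> lies strictly between
  the two half-spaces, so \<open>S = S\<^sub>a \<union> S\<^sub>b\<close> and \<open>\<zeta>\<close> is the smaller of the infima of \<open>f\<close> over
  \<open>S\<^sub>a\<close> and \<open>S\<^sub>b\<close>. The map \<open>\<Phi>\<close> carries each piece into its relaxation while turning \<open>f\<close> into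
  the linear function \<open>Q \<bullet> X\<close>, so a relaxed value is a lower bound for the value on the piece
  (\<open>min_value_le_lift\<close>). In particular the infimum over \<open>S\<^sub>a\<close> is at least \<open>\<zeta>hat\<^sub>a\<close>, hence
  exceeds \<open>\<eta> \<ge> \<zeta>\<close>: the piece \<open>S\<^sub>a\<close> cannot contribute to the overall infimum, which must
  therefore be the infimum over \<open>S\<^sub>b\<close>.
\<close>

lemma inner_integer_binary_Ints:
  fixes g x :: "real ^ 'n"
  assumes "g \<in> integer_vectors" and "x \<in> binary_points"
  shows "g \<bullet> x \<in> \<int>"
proof -
  have "g $ i * x $ i \<in> \<int>" for i
  proof (rule Ints_mult)
    show "g $ i \<in> \<int>"
      using assms(1) by (simp add: integer_vectors_def)
    have "x $ i = 0 \<or> x $ i = 1"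
      using assms(2) by (simp add: binary_points_def)
    then show "x $ i \<in> \<int>"
      by auto
  qed
  then show ?thesis
    by (simp add: inner_vec_def Ints_sum)
qed

lemma Ints_le_or_ge_add_one:
  fixes r :: real
  assumes "r \<in> \<int>"
  shows "r \<le> of_int k \<or> of_int k + 1 \<le> r"
proof -
  obtain m where "r = of_int m"
    using assms by (elim Ints_cases)
  moreover have "m \<le> k \<or> k + 1 \<le> m"
    by linarith
  ultimately show ?thesis
    by auto
qed

lemma min_value_Un: "min_value h (A \<union> B) = min (min_value h A) (min_value h B)"
  by (simp add: min_value_def INF_union inf_min)

text \<open>The principle behind relaxation bounds: every value of \<open>f\<close> on \<open>A\<close> is also a value of
  \<open>h\<close> on the larger domain \<open>T\<close>, namely at the lifted point.\<close>

lemma min_value_le_lift: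
  assumes "\<phi> ` A \<subseteq> T" and "\<And>x. x \<in> A \<Longrightarrow> h (\<phi> x) = f x"
  shows "min_value h T \<le> min_value f A"
  unfolding min_value_def
proof (rule INF_mono)
  fix x assume "x \<in> A"
  with assms show "\<exists>X\<in>T. ereal (h X) \<le> ereal (f x)"
    by (intro bexI[of _ "\<phi> x"]) auto
qed

theorem mainTheorem4:
  fixes S S\<^sub>a S\<^sub>b :: "(real ^ 'n) set"
    and f :: "real ^ 'n \<Rightarrow> real"
    and \<Phi> :: "real ^ 'n \<Rightarrow> real ^ 'l ^ 'l"
    and Q :: "real ^ 'l ^ 'l"
    and g :: "real ^ 'n"
    and \<alpha> \<eta> :: int
    and T\<^sub>a T\<^sub>b :: "(real ^ 'l ^ 'l) set"
    and \<zeta> \<zeta>\<^sub>b \<zeta>hat\<^sub>a \<zeta>hat\<^sub>b :: ereal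
  assumes "S \<noteq> {}" and "S \<subseteq> binary_points"
    and "\<And>x. x \<in> binary_points \<Longrightarrow> f x \<in> \<int>"
    and "\<zeta> = min_value f S"
    and "\<zeta> \<le> ereal (of_int \<eta>)"
    and "\<And>x. \<Phi> x \<in> sym_matrices"
    and "\<And>x. x \<in> binary_points \<Longrightarrow> \<Phi> x \<in> sym_matrices \<inter> integer_matrices"
    and "Q \<in> sym_matrices \<inter> integer_matrices"
    and "\<And>x. x \<in> binary_points \<Longrightarrow> Q \<bullet> \<Phi> x = f x"
    and "g \<in> integer_vectors"
    and "S\<^sub>a = {x \<in> S. g \<bullet> x \<le> of_int \<alpha>}"
    and "S\<^sub>b = {x \<in> S. g \<bullet> x \<ge> of_int \<alpha> + 1}"
    and "T\<^sub>a \<subseteq> sym_matrices" and "closed T\<^sub>a" and "convex T\<^sub>a"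
    and "T\<^sub>b \<subseteq> sym_matrices" and "closed T\<^sub>b" and "convex T\<^sub>b"
    and "\<Phi> ` S\<^sub>a \<subseteq> T\<^sub>a" and "\<Phi> ` S\<^sub>b \<subseteq> T\<^sub>b"
    and "\<zeta>\<^sub>b = min_value f S\<^sub>b"
    and "\<zeta>hat\<^sub>a = min_value (\<lambda>X. Q \<bullet> X) T\<^sub>a"
    and "\<zeta>hat\<^sub>b = min_value (\<lambda>X. Q \<bullet> X) T\<^sub>b"
    and "ereal (of_int \<eta>) < \<zeta>hat\<^sub>a"
  shows "\<zeta>hat\<^sub>b \<le> \<zeta>\<^sub>b \<and> \<zeta>\<^sub>b = \<zeta>"
proof -
  have "x \<in> S\<^sub>a \<union> S\<^sub>b" if "x \<in> S" for x
  proof -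
    have "g \<bullet> x \<in> \<int>"
      using that \<open>S \<subseteq> binary_points\<close> \<open>g \<in> integer_vectors\<close>
      by (blast intro: inner_integer_binary_Ints)
    then show ?thesis
      using that Ints_le_or_ge_add_one[of "g \<bullet> x" \<alpha>] assms(11,12) by blast
  qed
  then have split: "S = S\<^sub>a \<union> S\<^sub>b"
    using assms(11,12) by blast
  have lift: "Q \<bullet> \<Phi> x = f x" if "x \<in> S" for x
    using that \<open>S \<subseteq> binary_points\<close> assms(9) by blast
  have relax_a: "\<zeta>hat\<^sub>a \<le> min_value f S\<^sub>a"
    unfolding assms(22) by (rule min_value_le_lift[OF assms(19)]) (use lift split in blast)
  have relax_b: "\<zeta>hat\<^sub>b \<le> \<zeta>\<^sub>b"
    unfolding assms(21,23) by (rule min_value_le_lift[OF assms(20)]) (use lift split in blast)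
  have "\<zeta> < min_value f S\<^sub>a"
    using assms(5,24) relax_a by order
  moreover have "\<zeta> = min (min_value f S\<^sub>a) \<zeta>\<^sub>b"
    using assms(4,21) min_value_Un[of f S\<^sub>a S\<^sub>b] split by simp
  ultimately have "\<zeta>\<^sub>b = \<zeta>"
    by (auto simp: min_def split: if_splits)
  with relax_b show ?thesis
    by blast
qed

end
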